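(* Let $k,q,p\ge 3$ be integers with $q\ge p$, and let $C_k=\frac{1}{k+1}\binom{2k}{k}$ be the $k$-th Catalan number. There exist $c\ge 1$ and $t_0$ such that for all integers $t>t_0$: (a) if $p\le C_k-2$, then $r_{k+1}(t^c;q,p)>2^{r_k(t;q,p)-1}$; (b) if $p\le C_k$, then $r_{k+1}(t^c;2q+p,p)>2^{r_k(t;q,p)-1}$; (c) if $p\le k!$, then $r_{2k}(t^c;qp,p)>2^{r_k(t;q,p)-1}$.
   Context: $K_n^{(k)}$ is the complete $k$-uniform hypergraph on $n$ vertices. For integers $q\ge p$, $r_k(t;q,p)$ is the smallest integer $n$ such that in every colouring of the edges of $K_n^{(k)}$ with $q$ colours there is a set of $t$ vertices such that the $k$-edges contained in it receive fewer than $p$ distinct colours in total. For a real number $x$ that is not an integer, $r_k(x;q,p)$ is understood as $r_k(\lceil x\rceil;q,p)$. *)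

theory Defs
  imports Complex_Main "HOL-Library.Ramsey"
begin

text \<open>Every colouring of the edges of the complete \<open>k\<close>-uniform hypergraph on \<open>n\<close> vertices with
  the \<open>q\<close> colours \<open>0, \<dots>, q - 1\<close> (not all of which need be used) has a set of \<open>t\<close> vertices whose
  \<open>k\<close>-edges receive fewer than \<open>p\<close> distinct colours.\<close>

definition ramsey_prop :: "nat \<Rightarrow> nat \<Rightarrow> nat \<Rightarrow> nat \<Rightarrow> nat \<Rightarrow> bool" where
  "ramsey_prop k t q p n \<longleftrightarrow>
     (\<forall>\<chi> \<in> nsets {..<n} k \<rightarrow> {..<q}. \<exists>T \<in> nsets {..<n} t. card (\<chi> ` nsets T k) < p)"

definition ramsey_num :: "nat \<Rightarrow> nat \<Rightarrow> nat \<Rightarrow> nat \<Rightarrow> nat" where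
  "ramsey_num k t q p = (LEAST n. ramsey_prop k t q p n)"

definition ramsey_num_real :: "nat \<Rightarrow> real \<Rightarrow> nat \<Rightarrow> nat \<Rightarrow> nat" where
  "ramsey_num_real k x q p = ramsey_num k (nat \<lceil>x\<rceil>) q p"

definition catalan :: "nat \<Rightarrow> real" where
  "catalan k = 1 / (real k + 1) * real (2 * k choose k)"

text \<open>By Ramsey's theorem the minimum defining \<^const>\<open>ramsey_num\<close> exists. It is at least \<open>t\<close>, so
  the subtraction in \<open>ramsey_num k t q p - 1\<close> does not truncate when \<open>t \<ge> 1\<close>.\<close>

lemma ramsey_prop_exists:
  assumes "p \<ge> 2"
  shows "\<exists>n. ramsey_prop k t q p n"
proof -
  obtain N :: nat where N: "partn_lst {..<N} (replicate q t) k"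
    using ramsey_full by blast
  have "ramsey_prop k t q p N"
    unfolding ramsey_prop_def
  proof
    fix \<chi> assume "\<chi> \<in> nsets {..<N} k \<rightarrow> {..<q}"
    then obtain i T where "i < q" and T: "T \<in> nsets {..<N} t" "\<chi> ` nsets T k \<subseteq> {i}"
      using N unfolding partn_lst_def monochromatic_def by fastforce
    then have "card (\<chi> ` nsets T k) \<le> 1"
      using card_mono[of "{i}" "\<chi> ` nsets T k"] by simp
    with T assms show "\<exists>T \<in> nsets {..<N} t. card (\<chi> ` nsets T k) < p"
      by (intro bexI[of _ T]) auto
  qed
  then show ?thesis by blast
qed

lemma ramsey_prop_ramsey_num: "p \<ge> 2 \<Longrightarrow> ramsey_prop k t q p (ramsey_num k t q p)"
  unfolding ramsey_num_def by (rule LeastI_ex) (rule ramsey_prop_exists)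

lemma ramsey_num_ge:
  assumes "p \<ge> 2" "q \<ge> 1"
  shows "t \<le> ramsey_num k t q p"
proof -
  let ?n = "ramsey_num k t q p"
  have "(\<lambda>_. 0) \<in> nsets {..<?n} k \<rightarrow> {..<q}"
    using assms by auto
  then obtain T where "T \<in> nsets {..<?n} t"
    using ramsey_prop_ramsey_num[OF assms(1), of k t q] unfolding ramsey_prop_def by blast
  then have "T \<subseteq> {..<?n}" "card T = t"
    by (auto simp: nsets_def)
  then show ?thesis
    using card_mono[of "{..<?n}" T] by simp
qed

end

theory Submission
  imports Defs "HOL-Library.Tree" "HOL-Combinatorics.Multiset_Permutations"
begin

text \<open>
  Let \<open>N = r\<^sub>k(t;q,p) - 1\<close> and let \<open>\<chi>\<close> be a colouring of the \<open>k\<close>-subsets of \<open>{..<N}\<close> without a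
  \<open>t\<close>-set of fewer than \<open>p\<close> colours. A set of binary strings of length \<open>N\<close> spans a binary tree whose
  inner nodes are labelled by the positions at which the strings split.

  For (a) and (b), an edge whose tree is a comb gets the \<open>\<chi>\<close>-colour of its \<open>k\<close> labels (from
  separate palettes for left and right combs in (b)); other edges are coloured by the shape of their
  tree. A tree without a comb of \<open>t\<close> inner nodes has height below \<open>2 t\<close>, so if it has at least
  \<open>(2 t)\<^sup>k\<close> leaves then it contains a complete tree of height \<open>k\<close>, and hence all shapes, of which
  there are \<open>C\<^sub>k\<close>.

  For (c), pair up consecutive elements of an edge. The labels at which the \<open>k\<close> pairs split determine a
  \<open>\<chi>\<close>-colour and an order pattern in \<open>S\<^sub>k\<close>. In a large tree without long combs the height is linear
  in \<open>t\<close>. If \<open>t\<close> different labels occur at one depth, then \<open>\<chi>\<close> provides \<open>p\<close> colours. Otherwise there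
  are only \<open>O(t\<^sup>2)\<close> labels, and a Sauer-Shelah argument yields a complete binary tree whose labels
  depend on the depth only; in it all \<open>k!\<close> order patterns occur.
\<close>

section \<open>Induced subtrees\<close>

text \<open>\<open>induced u\<close> consists of the trees spanned by the nonempty sets of leaves of \<open>u\<close>.\<close>

fun induced :: "'a tree \<Rightarrow> 'a tree set" where
  "induced Leaf = {Leaf}"
| "induced (Node l a r) =
     induced l \<union> induced r \<union> (\<lambda>(l', r'). Node l' a r') ` (induced l \<times> induced r)"

lemma finite_induced [simp]: "finite (induced u)"
  by (induction u) auto

lemma Leaf_in_induced [simp]: "Leaf \<in> induced u"
  by (induction u) auto

lemma induced_NodeI: "l' \<in> induced l \<Longrightarrow> r' \<in> induced r \<Longrightarrow> Node l' a r' \<in> induced (Node l a r)"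
  by auto

lemma induced_leftI: "w \<in> induced l \<Longrightarrow> w \<in> induced (Node l a r)"
  and induced_rightI: "w \<in> induced r \<Longrightarrow> w \<in> induced (Node l a r)"
  by auto

lemma induced_trans: "w \<in> induced v \<Longrightarrow> v \<in> induced u \<Longrightarrow> w \<in> induced u"
proof (induction u arbitrary: v w)
  case (Node l a r)
  then consider "v \<in> induced l" | "v \<in> induced r"
    | l' r' where "v = Node l' a r'" "l' \<in> induced l" "r' \<in> induced r"
    by auto
  then show ?case
  proof cases
    case 3
    with Node.prems(1) consider "w \<in> induced l'" | "w \<in> induced r'"
      | l'' r'' where "w = Node l'' a r''" "l'' \<in> induced l'" "r'' \<in> induced r'"
      by auto
    then show ?thesis
      using Node.IH 3 by cases (auto intro: induced_leftI induced_rightI induced_NodeI simp del: induced.simps)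
  qed (use Node in \<open>auto intro: induced_leftI induced_rightI simp del: induced.simps\<close>)
qed simp

lemma set_tree_induced: "w \<in> induced u \<Longrightarrow> set_tree w \<subseteq> set_tree u"
proof (induction u arbitrary: w)
  case (Node l a r)
  from Node.prems show ?case
    using Node.IH by auto blast+
qed simp

text \<open>Labels may repeat in different branches, since both sides of a split can split again at
  the same position. Along a path of \<open>cart n A\<close> the positions decrease.\<close>

fun path_distinct :: "'a tree \<Rightarrow> bool" where
  "path_distinct Leaf \<longleftrightarrow> True"
| "path_distinct (Node l a r) \<longleftrightarrow>
     a \<notin> set_tree l \<union> set_tree r \<and> path_distinct l \<and> path_distinct r"

lemma path_distinct_induced: "w \<in> induced u \<Longrightarrow> path_distinct u \<Longrightarrow> path_distinct w"
proof (induction u arbitrary: w)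
  case (Node l a r)
  from Node.prems show ?case
    using Node.IH set_tree_induced by auto blast+
qed simp

section \<open>The tree of a set of binary strings\<close>

text \<open>Numbers below \<open>2 ^ n\<close> serve as binary strings, read from the most
  significant bit; positions without a split are skipped. For a set of such numbers, inorder lists
  the highest differing bits of consecutive elements, and the tree is the Cartesian tree of this
  list, with the maximum at the root.\<close>

fun cart :: "nat \<Rightarrow> nat set \<Rightarrow> nat tree" where
  "cart 0 A = Leaf"
| "cart (Suc n) A =
     (if (\<exists>x\<in>A. bit x n) \<and> (\<exists>x\<in>A. \<not> bit x n)
      then Node (cart n {x \<in> A. \<not> bit x n}) n (cart n {x \<in> A. bit x n}) else cart n A)"

lemma set_tree_cart: "set_tree (cart n A) \<subseteq> {..<n}"
proof (induction n arbitrary: A)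
  case (Suc n)
  have "set_tree (cart n B) \<subseteq> {..<Suc n}" for B
    using Suc[of B] by auto
  then show ?case
    by simp
qed simp

lemma path_distinct_cart: "path_distinct (cart n A)"
proof (induction n arbitrary: A)
  case (Suc n)
  show ?case
    using Suc set_tree_cart[of n] by auto
qed simp

text \<open>Leaves correspond to elements. The low bits separate each half because bit
  \<open>n\<close> is constant there, and they separate all of \<open>A\<close> if position
  \<open>n\<close> does not split it.\<close>

lemma size1_cart:
  "finite A \<Longrightarrow> A \<noteq> {} \<Longrightarrow> inj_on (take_bit n) A \<Longrightarrow> size1 (cart n A) = card A"
proof (induction n arbitrary: A)
  case 0
  then obtain a where "a \<in> A" by auto
  with 0 have "A = {a}" by (auto simp: inj_on_def)
  then show ?case by simp
next
  case (Suc n)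
  have inj: "inj_on (take_bit n) {x \<in> A. bit x n = b}" for b
    using Suc.prems(3) by (auto simp: inj_on_def take_bit_Suc_from_most)
  have card: "card A = card {x \<in> A. \<not> bit x n} + card {x \<in> A. bit x n}"
    using Suc.prems(1) by (subst card_Un_disjoint[symmetric]) (auto intro: arg_cong[where f = card])
  show ?case
  proof (cases "(\<exists>x\<in>A. bit x n) \<and> (\<exists>x\<in>A. \<not> bit x n)")
    case True
    then have "size1 (cart (Suc n) A) =
        size1 (cart n {x \<in> A. \<not> bit x n}) + size1 (cart n {x \<in> A. bit x n})"
      by simp
    also have "\<dots> = card {x \<in> A. \<not> bit x n} + card {x \<in> A. bit x n}"
      using True Suc.prems(1) inj[of False] inj[of True] by (intro arg_cong2[where f = "(+)"] Suc.IH) auto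
    finally show ?thesis
      using card by simp
  next
    case False
    then consider "{x \<in> A. bit x n = True} = A" | "{x \<in> A. bit x n = False} = A"
      by auto
    then have "inj_on (take_bit n) A"
      by cases (use inj[of True] inj[of False] in simp_all)
    with False show ?thesis
      using Suc.IH[of A] Suc.prems by auto
  qed
qed

text \<open>Subsets chosen on the two sides of a split are united; a position that does not split
  \<open>A\<close> splits no subset either.\<close>

lemma induced_cart:
  "w \<in> induced (cart n A) \<Longrightarrow> A \<noteq> {} \<Longrightarrow> \<exists>B\<subseteq>A. B \<noteq> {} \<and> cart n B = w"
proof (induction n arbitrary: A w)
  case 0
  then show ?case by auto
next
  case (Suc n)
  let ?A0 = "{x \<in> A. \<not> bit x n}" and ?A1 = "{x \<in> A. bit x n}"
  show ?case
  proof (cases "(\<exists>x\<in>A. bit x n) \<and> (\<exists>x\<in>A. \<not> bit x n)")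
    case True
    then have ne: "?A0 \<noteq> {}" "?A1 \<noteq> {}" by auto
    from True Suc.prems(1) consider "w \<in> induced (cart n ?A0)" | "w \<in> induced (cart n ?A1)"
      | l r where "w = Node l n r" "l \<in> induced (cart n ?A0)" "r \<in> induced (cart n ?A1)"
      by auto
    then show ?thesis
    proof cases
      case 1
      then obtain B where "B \<subseteq> ?A0" "B \<noteq> {}" "cart n B = w"
        using Suc.IH ne by blast
      then show ?thesis
        by (intro exI[of _ B]) auto
    next
      case 2
      then obtain B where "B \<subseteq> ?A1" "B \<noteq> {}" "cart n B = w"
        using Suc.IH ne by blast
      then show ?thesis
        by (intro exI[of _ B]) auto
    next
      case 3
      then obtain B C where B: "B \<subseteq> ?A0" "B \<noteq> {}" "cart n B = l"
        and C: "C \<subseteq> ?A1" "C \<noteq> {}" "cart n C = r"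
        using Suc.IH ne by meson
      then have "{x \<in> B \<union> C. \<not> bit x n} = B" "{x \<in> B \<union> C. bit x n} = C"
        by auto
      moreover have "\<exists>x\<in>B \<union> C. bit x n" "\<exists>x\<in>B \<union> C. \<not> bit x n"
        using B C by blast+
      ultimately have "cart (Suc n) (B \<union> C) = w"
        using B C 3 by simp
      then show ?thesis
        using B C by (intro exI[of _ "B \<union> C"]) auto
    qed
  next
    case False
    then have "w \<in> induced (cart n A)"
      using Suc.prems(1) by auto
    then obtain B where "B \<subseteq> A" "B \<noteq> {}" "cart n B = w"
      using Suc.IH Suc.prems(2) by blast
    moreover from this False have "cart (Suc n) B = cart n B"
      by auto
    ultimately show ?thesis by blast
  qed
qed

text \<open>A stepping-up colouring is a colouring of trees: the edge \<open>A\<close> gets the colour of its tree.\<close>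

lemma ramsey_num_gt_two_power:
  fixes col :: "nat tree \<Rightarrow> nat"
  assumes "p \<ge> 2" "m \<ge> 1" "s \<ge> 1"
    and col: "\<And>w. path_distinct w \<Longrightarrow> set_tree w \<subseteq> {..<N} \<Longrightarrow> size1 w = s \<Longrightarrow> col w < Q"
    and many: "\<And>u. path_distinct u \<Longrightarrow> set_tree u \<subseteq> {..<N} \<Longrightarrow> size1 u = m \<Longrightarrow>
      p \<le> card (col ` {w \<in> induced u. size1 w = s})"
  shows "2 ^ N < ramsey_num s m Q p"
proof (rule ccontr)
  define n where "n = ramsey_num s m Q p"
  assume "\<not> ?thesis"
  then have n: "n \<le> 2 ^ N" by (simp add: n_def)
  have size: "size1 (cart N A) = card A" if "A \<subseteq> {..<n}" "A \<noteq> {}" for A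
  proof (rule size1_cart)
    show "inj_on (take_bit N) A"
    proof (rule inj_onI)
      fix x y assume "x \<in> A" "y \<in> A" "take_bit N x = take_bit N y"
      moreover from this that n have "x < 2 ^ N" "y < 2 ^ N"
        by force+
      ultimately show "x = y"
        by (simp add: take_bit_nat_eq_self)
    qed
  qed (use that finite_subset in auto)
  have "(\<lambda>A. col (cart N A)) \<in> nsets {..<n} s \<rightarrow> {..<Q}"
  proof
    fix A assume "A \<in> nsets {..<n} s"
    then have "A \<subseteq> {..<n}" "card A = s"
      by (auto simp: nsets_def)
    with \<open>s \<ge> 1\<close> show "col (cart N A) \<in> {..<Q}"
      using size[of A] card.empty by (fastforce intro!: col path_distinct_cart set_tree_cart)
  qed
  moreover have "ramsey_prop s m Q p n"
    unfolding n_def by (rule ramsey_prop_ramsey_num) fact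
  ultimately obtain T where T: "T \<in> nsets {..<n} m"
    and few: "card ((\<lambda>A. col (cart N A)) ` nsets T s) < p"
    unfolding ramsey_prop_def by blast
  from T have T': "T \<subseteq> {..<n}" "card T = m" "finite T"
    by (auto simp: nsets_def)
  with \<open>m \<ge> 1\<close> have "T \<noteq> {}" by auto
  \<comment> \<open>Colours are counted from below, so it suffices that every subtree with
    \<open>s\<close> leaves comes from an edge inside \<open>T\<close>.\<close>
  have "{w \<in> induced (cart N T). size1 w = s} \<subseteq> cart N ` nsets T s"
  proof
    fix w assume "w \<in> {w \<in> induced (cart N T). size1 w = s}"
    then have w: "w \<in> induced (cart N T)" "size1 w = s"
      by auto
    then obtain B where "B \<subseteq> T" "B \<noteq> {}" "cart N B = w"
      using induced_cart \<open>T \<noteq> {}\<close> by blast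
    moreover from this have "card B = s"
      using size[of B] w T' by auto
    ultimately show "w \<in> cart N ` nsets T s"
      using T' finite_subset[of B T] by (auto simp: nsets_def)
  qed
  then have "card (col ` {w \<in> induced (cart N T). size1 w = s}) \<le> card (col ` cart N ` nsets T s)"
    using T' by (intro card_mono finite_imageI image_mono finite_imp_finite_nsets) auto
  moreover have "p \<le> card (col ` {w \<in> induced (cart N T). size1 w = s})"
    using T' \<open>T \<noteq> {}\<close> by (intro many path_distinct_cart set_tree_cart) (simp add: size)
  ultimately show False
    using few by (simp add: image_image)
qed

section \<open>Combs and complete trees\<close>

text \<open>In the tree of a set, right combs are the case of decreasing splitting positions of
  consecutive elements, left combs that of increasing ones.\<close>

fun rcomb :: "'a list \<Rightarrow> 'a tree" where
  "rcomb [] = Leaf"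
| "rcomb (x # xs) = Node Leaf x (rcomb xs)"

fun lcomb :: "'a list \<Rightarrow> 'a tree" where
  "lcomb [] = Leaf"
| "lcomb (x # xs) = Node (lcomb xs) x Leaf"

lemma set_tree_rcomb [simp]: "set_tree (rcomb xs) = set xs"
  and set_tree_lcomb [simp]: "set_tree (lcomb xs) = set xs"
  and size_rcomb [simp]: "size (rcomb xs) = length xs"
  and size_lcomb [simp]: "size (lcomb xs) = length xs"
  and path_distinct_rcomb [simp]: "path_distinct (rcomb xs) \<longleftrightarrow> distinct xs"
  and path_distinct_lcomb [simp]: "path_distinct (lcomb xs) \<longleftrightarrow> distinct xs"
  and map_tree_rcomb [simp]: "map_tree f (rcomb xs) = rcomb (map f xs)"
  and map_tree_lcomb [simp]: "map_tree f (lcomb xs) = lcomb (map f xs)"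
  by (induction xs) auto

text \<open>With a single inner node the two kinds of comb can coincide.\<close>

lemma rcomb_neq_lcomb: "length xs \<ge> 2 \<Longrightarrow> rcomb xs \<noteq> lcomb ys"
  by (cases xs rule: rcomb.cases; cases ys; cases "tl xs") auto

text \<open>Dropping a label means passing to the right subtree of its node. Hence every set of
  labels of a comb is the label set of a smaller comb.\<close>

lemma rcomb_filter_induced: "rcomb (filter P xs) \<in> induced (rcomb xs)"
  by (induction xs) (auto simp del: induced.simps intro: induced_rightI induced_NodeI)

lemma lcomb_filter_induced: "lcomb (filter P xs) \<in> induced (lcomb xs)"
  by (induction xs) (auto simp del: induced.simps intro: induced_leftI induced_NodeI)

text \<open>The nodes where a longest path turns left span a left comb, those where it turns right a
  right comb.\<close>

lemma height_le_combs:
  "\<exists>xs ys. rcomb xs \<in> induced u \<and> lcomb ys \<in> induced u \<and> height u \<le> length xs + length ys"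
proof (induction u)
  case Leaf
  show ?case by (intro exI[of _ "[]"]) simp
next
  case (Node l a r)
  then obtain xs ys xs' ys' where
    l: "rcomb xs \<in> induced l" "lcomb ys \<in> induced l" "height l \<le> length xs + length ys" and
    r: "rcomb xs' \<in> induced r" "lcomb ys' \<in> induced r" "height r \<le> length xs' + length ys'"
    by blast
  show ?case
  proof (cases "height r \<le> height l")
    case True
    have "rcomb xs \<in> induced (Node l a r)" "lcomb (a # ys) \<in> induced (Node l a r)"
      using l by auto
    moreover have "height (Node l a r) \<le> length xs + length (a # ys)"
      using True l by simp
    ultimately show ?thesis by blast
  next
    case False
    have "rcomb (a # xs') \<in> induced (Node l a r)" "lcomb ys' \<in> induced (Node l a r)"
      using r by auto
    moreover have "height (Node l a r) \<le> length (a # xs') + length ys'"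
      using False r by simp
    ultimately show ?thesis by blast
  qed
qed

text \<open>The largest such \<open>s\<close> is the Horton-Strahler number of the tree, with leaves
  counted as 0.\<close>

fun has_complete :: "nat \<Rightarrow> 'a tree \<Rightarrow> bool" where
  "has_complete 0 u \<longleftrightarrow> True"
| "has_complete (Suc s) Leaf \<longleftrightarrow> False"
| "has_complete (Suc s) (Node l a r) \<longleftrightarrow>
     has_complete s l \<and> has_complete s r \<or> has_complete (Suc s) l \<or> has_complete (Suc s) r"

text \<open>At most one side of the root contains a complete tree of height \<open>s\<close>. With
  \<open>h\<close> the height of the node this gives at most \<open>h ^ s + h ^ (s - 1)\<close>
  leaves.\<close>

lemma size1_le_if_not_has_complete:
  "\<not> has_complete (Suc s) u \<Longrightarrow> size1 u \<le> (height u + 1) ^ s"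
proof (induction u arbitrary: s)
  case (Node l a r)
  define h where "h = max (height l) (height r) + 1"
  \<comment> \<open>Any inner node is already a complete tree of height 1, so \<open>s\<close> is
    positive.\<close>
  from Node.prems obtain s' where s: "s = Suc s'"
    by (cases s) auto
  have pw: "size1 v \<le> h ^ j" if "size1 v \<le> (height v + 1) ^ j" "v = l \<or> v = r" for v j
    using that power_mono[of "height v + 1" h j] by (auto simp: h_def)
  have "size1 l \<le> h ^ s" "size1 r \<le> h ^ s"
    using Node by (auto intro!: pw)
  moreover have "size1 l \<le> h ^ s' \<or> size1 r \<le> h ^ s'"
    using Node s by (auto intro!: pw)
  ultimately have "size1 (Node l a r) \<le> h ^ s + h ^ s'"
    by auto
  also have "\<dots> = (h + 1) * h ^ s'"
    by (simp add: s)
  also have "\<dots> \<le> (h + 1) * (h + 1) ^ s'"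
    by (intro mult_left_mono power_mono) auto
  finally show ?case
    by (simp add: s h_def)
qed simp

abbreviation shape :: "'a tree \<Rightarrow> unit tree" where
  "shape \<equiv> map_tree (\<lambda>_. ())"

text \<open>At a node where both sides keep a complete tree of height \<open>s\<close>, the sides
  host the two subtrees of \<open>v\<close>.\<close>

lemma has_complete_shape:
  "has_complete s u \<Longrightarrow> height v \<le> s \<Longrightarrow> \<exists>w\<in>induced u. shape w = v"
proof (induction s u arbitrary: v rule: has_complete.induct)
  case (1 u)
  then show ?case by (intro bexI[of _ Leaf]) auto
next
  case (3 s l a r)
  show ?case
  proof (cases v)
    case Leaf
    then show ?thesis by (intro bexI[of _ Leaf]) auto
  next
    case (Node v1 x v2)
    from 3(5) consider "has_complete s l" "has_complete s r"
      | "has_complete (Suc s) l" | "has_complete (Suc s) r"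
      by auto
    then show ?thesis
    proof cases
      case 1
      then obtain w1 w2 where "w1 \<in> induced l" "shape w1 = v1" "w2 \<in> induced r" "shape w2 = v2"
        using 3(1)[of v1] 3(2)[of v2] 3(6) Node by auto
      then show ?thesis
        using Node by (intro bexI[of _ "Node w1 a w2"] induced_NodeI) auto
    next
      case 2
      then show ?thesis using 3(3)[of v] 3(6) by auto
    next
      case 3
      then show ?thesis using "3.IH"(4)[of v] "3.prems" by auto
    qed
  qed
qed simp

lemma height_le_size: "height (u :: 'a tree) \<le> size u"
  by (induction u) auto

lemma comb_or_all_shapes:
  assumes "(2 * t) ^ k \<le> size1 u" "t \<ge> 1" "k \<ge> 1"
  shows "(\<exists>xs. length xs \<ge> t \<and> rcomb xs \<in> induced u) \<or>
    (\<exists>xs. length xs \<ge> t \<and> lcomb xs \<in> induced u) \<or>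
    (\<forall>v. size v = k \<longrightarrow> (\<exists>w\<in>induced u. shape w = v))"
proof (cases "has_complete k u")
  case True
  then show ?thesis
    using has_complete_shape height_le_size by blast
next
  case False
  obtain k' where k: "k = Suc k'"
    using \<open>k \<ge> 1\<close> by (cases k) auto
  obtain xs ys where xy: "rcomb xs \<in> induced u" "lcomb ys \<in> induced u"
    "height u \<le> length xs + length ys"
    using height_le_combs by blast
  have "length xs \<ge> t \<or> length ys \<ge> t"
  proof (rule ccontr)
    assume "\<not> ?thesis"
    \<comment> \<open>Both combs have at most \<open>t - 1\<close> nodes, so the height is at most
      \<open>2 * t - 2\<close>.\<close>
    with xy have h: "height u + 1 < 2 * t" by simp
    have "size1 u \<le> (height u + 1) ^ k'"
      using size1_le_if_not_has_complete False k by blast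
    also have "\<dots> \<le> (2 * t) ^ k'"
      using h by (intro power_mono) auto
    also have "\<dots> < (2 * t) ^ k"
      using h k by simp
    finally show False
      using assms by simp
  qed
  then show ?thesis using xy by blast
qed

section \<open>Counting binary trees\<close>

text \<open>Lists of trees replace single trees so that deleting the root of the first tree yields a
  linear recursion instead of a convolution.\<close>

definition forests :: "nat \<Rightarrow> nat \<Rightarrow> unit tree list set" where
  "forests n m = {ts. length ts = m \<and> sum_list (map size ts) = n}"

lemma forests_0: "forests 0 m = {replicate m Leaf}"
proof
  show "forests 0 m \<subseteq> {replicate m Leaf}"
    by (auto simp: forests_def intro!: replicate_eqI)
  show "{replicate m Leaf} \<subseteq> forests 0 m"
    by (simp add: forests_def sum_list_replicate)
qed

lemma forests_Suc_0: "forests (Suc n) 0 = {}"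
  by (auto simp: forests_def)

text \<open>Either the first tree is a leaf and is dropped, or its root is deleted and its two
  subtrees join the list.\<close>

lemma forests_Suc_Suc:
  "forests (Suc n) (Suc m) =
     Cons Leaf ` forests (Suc n) m \<union> (\<lambda>ts. Node (ts ! 0) () (ts ! 1) # drop 2 ts) ` forests n (m + 2)"
  (is "?L = ?R")
proof
  show "?L \<subseteq> ?R"
  proof
    fix ts assume "ts \<in> ?L"
    then obtain t us where ts: "ts = t # us" "length us = m" "size t + sum_list (map size us) = Suc n"
      by (cases ts) (auto simp: forests_def)
    show "ts \<in> ?R"
    proof (cases t)
      case Leaf
      with ts show ?thesis by (auto simp: forests_def)
    next
      case (Node l x r)
      with ts have "l # r # us \<in> forests n (m + 2)"
        by (auto simp: forests_def)
      then show ?thesis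
        using Node ts by (intro UnI2 image_eqI[where x = "l # r # us"]) auto
    qed
  qed
  show "?R \<subseteq> ?L"
  proof
    fix ts assume "ts \<in> ?R"
    then consider us where "ts = Leaf # us" "us \<in> forests (Suc n) m"
      | us where "ts = Node (us ! 0) () (us ! 1) # drop 2 us" "us \<in> forests n (m + 2)"
      by auto
    then show "ts \<in> ?L"
    proof cases
      case 2
      then obtain l r vs where "us = l # r # vs"
        by (auto simp: forests_def length_Suc_conv)
      with 2 show ?thesis by (auto simp: forests_def)
    qed (auto simp: forests_def)
  qed
qed

lemma finite_forests: "finite (forests n m)"
proof (induction n arbitrary: m)
  case (Suc n)
  show ?case
    by (induction m) (auto simp: forests_Suc_0 forests_Suc_Suc Suc)
qed (simp add: forests_0)

lemma card_forests_Suc_Suc: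
  "card (forests (Suc n) (Suc m)) = card (forests (Suc n) m) + card (forests n (m + 2))"
proof -
  have inj: "inj_on (\<lambda>ts. Node (ts ! 0) () (ts ! 1) # drop 2 ts) (forests n (m + 2))"
  proof (rule inj_onI)
    fix x y assume xy: "x \<in> forests n (m + 2)" "y \<in> forests n (m + 2)"
      and eq: "Node (x ! 0) () (x ! 1) # drop 2 x = Node (y ! 0) () (y ! 1) # drop 2 y"
    have "\<exists>a b z'. z = a # b # z'" if "z \<in> forests n (m + 2)" for z
      using that by (simp add: forests_def length_Suc_conv) blast
    with xy obtain a b x' c d y' where "x = a # b # x'" "y = c # d # y'"
      by metis
    with eq show "x = y" by simp
  qed
  show ?thesis
    unfolding forests_Suc_Suc
    by (subst card_Un_disjoint) (auto simp: finite_forests card_image inj[simplified])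
qed

text \<open>The ballot number formula, written without subtraction. By Pascal's rule both sides obey
  the recursion of \<open>card_forests_Suc_Suc\<close>; for \<open>m = 0\<close> it is the symmetry
  of binomial coefficients.\<close>

lemma card_forests_Suc:
  "card (forests (Suc n) m) + ((2 * n + 1 + m) choose n) = (2 * n + 1 + m) choose (n + 1)"
proof (induction n arbitrary: m)
  case 0
  show ?case
    by (induction m) (auto simp: forests_Suc_0 card_forests_Suc_Suc forests_0)
next
  case (Suc n)
  note IH = Suc.IH
  show ?case
  proof (induction m)
    case 0
    show ?case
      using binomial_symmetric[of "Suc n" "2 * Suc n + 1"] by (simp add: forests_Suc_0)
  next
    case (Suc m)
    then show ?case
      using IH[of "m + 2"] by (simp add: card_forests_Suc_Suc)
  qed
qed

lemma card_binary_trees: "real (card {v :: unit tree. size v = k}) = catalan k"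
proof (cases k)
  case 0
  then have "{v :: unit tree. size v = k} = {Leaf}"
    by auto
  then show ?thesis
    using 0 by (simp add: catalan_def)
next
  case (Suc n)
  have "bij_betw (\<lambda>v. [v]) {v :: unit tree. size v = k} (forests k 1)"
    by (rule bij_betwI[where g = hd]) (auto simp: forests_def length_Suc_conv)
  then have "card {v :: unit tree. size v = k} = card (forests k 1)"
    by (rule bij_betw_same_card)
  then have eq: "real (card {v :: unit tree. size v = k}) = 
      real (2 * k choose k) - real (2 * k choose n)"
    using card_forests_Suc[of n 1] Suc by (simp flip: of_nat_add)
  \<comment> \<open>This turns the difference of binomials into the Catalan number.\<close>
  have "k * (2 * k choose k) = (k + 1) * (2 * k choose n)"
    using Suc_times_binomial[of n "2 * n + 1"] binomial_absorb_comp[of "2 * k" n] Suc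
    by simp
  then have "real (k * (2 * k choose k)) = real ((k + 1) * (2 * k choose n))"
    by simp
  then have "real k * real (2 * k choose k) = (real k + 1) * real (2 * k choose n)"
    by (simp only: of_nat_mult of_nat_add of_nat_1)
  then show ?thesis
    unfolding eq catalan_def by (simp add: field_simps)
qed

section \<open>Stepping up with combs\<close>

lemma shape_rcombD: "shape w = rcomb ys \<Longrightarrow> \<exists>xs. w = rcomb xs"
proof (induction ys arbitrary: w)
  case Nil
  then have "w = rcomb []" by simp
  then show ?case ..
next
  case (Cons y ys)
  then obtain x r where w: "w = Node Leaf x r" "shape r = rcomb ys"
    by (cases w) auto
  with Cons.IH obtain xs where "r = rcomb xs" by blast
  with w have "w = rcomb (x # xs)" by simp
  then show ?case ..
qed

lemma shape_lcombD: "shape w = lcomb ys \<Longrightarrow> \<exists>xs. w = lcomb xs"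
proof (induction ys arbitrary: w)
  case Nil
  then have "w = lcomb []" by simp
  then show ?case ..
next
  case (Cons y ys)
  then obtain x l where w: "w = Node l x Leaf" "shape l = lcomb ys"
    by (cases w) auto
  with Cons.IH obtain xs where "l = lcomb xs" by blast
  with w have "w = lcomb (x # xs)" by simp
  then show ?case ..
qed

lemma ex_surjection_lessThan:
  fixes n :: nat
  assumes "finite A" "n \<le> card A" "0 < n"
  shows "\<exists>g. g ` A = {..<n} \<and> (\<forall>x. g x < n)"
proof -
  obtain h where h: "bij_betw h A {0..<card A}"
    using ex_bij_betw_finite_nat[OF \<open>finite A\<close>] by blast
  \<comment> \<open>The default 0 bounds \<open>g\<close> everywhere, so later colour ranges need no
    membership condition.\<close>
  define g where "g = (\<lambda>x. if h x < n then h x else 0)"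
  have "{..<n} \<subseteq> g ` A"
  proof
    fix i assume "i \<in> {..<n}"
    with assms have "i \<in> h ` A"
      using h by (auto simp: bij_betw_def)
    with \<open>i \<in> {..<n}\<close> show "i \<in> g ` A"
      by (force simp: g_def)
  qed
  moreover have "g x < n" for x
    using assms by (simp add: g_def)
  ultimately show ?thesis
    by (intro exI[of _ g]) auto
qed

definition noncombs :: "nat \<Rightarrow> unit tree set" where
  "noncombs k = {v. size v = k} - {rcomb (replicate k ()), lcomb (replicate k ())}"

lemma finite_binary_trees: "finite {v :: unit tree. size v = k}"
proof -
  have "(\<lambda>v. [v]) ` {v. size v = k} \<subseteq> forests k 1"
    by (auto simp: forests_def)
  then have "finite ((\<lambda>v. [v]) ` {v :: unit tree. size v = k})"
    using finite_forests finite_subset by blast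
  then show ?thesis
    by (rule finite_imageD) (simp add: inj_on_def)
qed

lemma card_noncombs: "catalan k - 2 \<le> real (card (noncombs k))"
proof -
  have "card {v :: unit tree. size v = k} \<le>
      card (noncombs k) + card {rcomb (replicate k ()), lcomb (replicate k ())}"
    unfolding noncombs_def
    using diff_card_le_card_Diff[of "{rcomb (replicate k ()), lcomb (replicate k ())}"
        "{v :: unit tree. size v = k}"]
    by simp
  also have "card {rcomb (replicate k ()), lcomb (replicate k ())} \<le> 2"
    by (simp add: card_insert_if)
  finally show ?thesis
    by (simp flip: card_binary_trees)
qed

text \<open>Common core of (a) and (b). Right combs use colours from 0, left combs from
  \<open>e\<close>, other shapes from \<open>b\<close>; the choice of offsets decides whether the
  palettes overlap.\<close>

lemma step_up_combs:
  assumes notr: "\<not> ramsey_prop k t q p N" and "k \<ge> 2" "p \<ge> 2" "t \<ge> 1" "(2 * t) ^ k \<le> m"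
    and Q: "e + q \<le> Q" and g: "\<And>v. v \<in> noncombs k \<Longrightarrow> b + g v < Q"
    and shapes: "\<And>c c'. c < q \<Longrightarrow> c' < q \<Longrightarrow>
      p \<le> card (insert c (insert (e + c') ((\<lambda>v. b + g v) ` noncombs k)))"
  shows "2 ^ N < ramsey_num (k + 1) m Q p"
proof -
  from notr obtain \<chi> where chi: "\<chi> \<in> nsets {..<N} k \<rightarrow> {..<q}"
    and many: "\<And>T. T \<in> nsets {..<N} t \<Longrightarrow> p \<le> card (\<chi> ` nsets T k)"
    unfolding ramsey_prop_def by (auto simp: not_less)
  define col where "col w =
    (if \<exists>xs. w = rcomb xs then \<chi> (set_tree w)
     else if \<exists>xs. w = lcomb xs then e + \<chi> (set_tree w) else b + g (shape w))" for w
  have chi_less: "\<chi> (set xs) < q" if "distinct xs" "length xs = k" "set xs \<subseteq> {..<N}" for xs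
    using that chi by (auto simp: nsets_def Pi_iff distinct_card)
  have col_rcomb: "col (rcomb xs) = \<chi> (set xs)" for xs
    by (auto simp: col_def)
  have col_lcomb: "col (lcomb xs) = e + \<chi> (set xs)" if "length xs = k" for xs
  proof -
    have "lcomb xs \<noteq> rcomb ys" for ys
      using rcomb_neq_lcomb[of ys xs] size_rcomb[of ys] size_lcomb[of xs] that \<open>k \<ge> 2\<close> by metis
    then show ?thesis by (auto simp: col_def)
  qed
  show ?thesis
  proof (rule ramsey_num_gt_two_power[where col = col])
    have "0 < (2 * t) ^ k"
      using \<open>t \<ge> 1\<close> by simp
    with \<open>(2 * t) ^ k \<le> m\<close> show "1 \<le> m"
      by linarith
  next
    fix w assume w: "path_distinct w" "set_tree w \<subseteq> {..<N}" "size1 w = k + 1"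
    consider (r) xs where "w = rcomb xs" | (l) xs where "w = lcomb xs"
      | (n) "\<nexists>xs. w = rcomb xs" "\<nexists>xs. w = lcomb xs"
      by blast
    then show "col w < Q"
    proof cases
      case r
      then show ?thesis
        using w chi_less[of xs] col_rcomb Q by (simp add: size1_size)
    next
      case l
      then show ?thesis
        using w chi_less[of xs] col_lcomb[of xs] Q by (simp add: size1_size)
    next
      case n
      then have "shape w \<in> noncombs k"
        using w shape_rcombD[of w "replicate k ()"] shape_lcombD[of w "replicate k ()"]
        by (auto simp: noncombs_def size1_size)
      with n show ?thesis
        using g[of "shape w"] by (simp add: col_def)
    qed
  next
    fix u assume u: "path_distinct u" "set_tree u \<subseteq> {..<N}" "size1 u = m"
    let ?C = "col ` {w \<in> induced u. size1 w = k + 1}"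
    have ind: "path_distinct w \<and> set_tree w \<subseteq> {..<N}" if "w \<in> induced u" for w
      using that u path_distinct_induced set_tree_induced by blast
    consider (r) xs where "length xs \<ge> t" "rcomb xs \<in> induced u"
      | (l) xs where "length xs \<ge> t" "lcomb xs \<in> induced u"
      | (s) "\<And>v. size v = k \<Longrightarrow> \<exists>w\<in>induced u. shape w = v"
      using comb_or_all_shapes[of t k u] assms u by auto
    then show "p \<le> card ?C"
    proof cases
      case r
      then have xs: "distinct xs" "set xs \<subseteq> {..<N}"
        using ind[of "rcomb xs"] by auto
      then obtain Y where Y: "Y \<subseteq> set xs" "card Y = t" "finite Y"
        using obtain_subset_with_card_n[of t "set xs"] r by (auto simp: distinct_card)
      \<comment> \<open>Each \<open>k\<close>-subset of the labels of the long comb is the label set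
        of a comb with \<open>k + 1\<close> leaves.\<close>
      have "\<chi> ` nsets Y k \<subseteq> ?C"
      proof safe
        fix K assume "K \<in> nsets Y k"
        define ys where "ys = filter (\<lambda>x. x \<in> K) xs"
        have ys: "set ys = K" "distinct ys" "length ys = k"
          using \<open>K \<in> nsets Y k\<close> Y xs
          by (auto simp: ys_def nsets_def simp flip: distinct_card[OF distinct_filter])
             (metis Int_absorb1 Int_def order_trans)
        have "rcomb ys \<in> induced u"
          unfolding ys_def using rcomb_filter_induced r induced_trans by blast
        moreover have "col (rcomb ys) = \<chi> K"
          using col_rcomb ys by simp
        ultimately show "\<chi> K \<in> ?C"
          using ys by (intro image_eqI[of _ _ "rcomb ys"]) (auto simp: size1_size)
      qed
      then have "card (\<chi> ` nsets Y k) \<le> card ?C"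
        by (intro card_mono) auto
      moreover have "Y \<in> nsets {..<N} t"
        using Y xs by (simp add: nsets_def subset_trans)
      ultimately show ?thesis
        using many[of Y] by linarith
    next
      case l
      then have xs: "distinct xs" "set xs \<subseteq> {..<N}"
        using ind[of "lcomb xs"] by auto
      then obtain Y where Y: "Y \<subseteq> set xs" "card Y = t" "finite Y"
        using obtain_subset_with_card_n[of t "set xs"] l by (auto simp: distinct_card)
      have "(+) e ` \<chi> ` nsets Y k \<subseteq> ?C"
      proof safe
        fix K assume "K \<in> nsets Y k"
        define ys where "ys = filter (\<lambda>x. x \<in> K) xs"
        have ys: "set ys = K" "distinct ys" "length ys = k"
          using \<open>K \<in> nsets Y k\<close> Y xs
          by (auto simp: ys_def nsets_def simp flip: distinct_card[OF distinct_filter])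
             (metis Int_absorb1 Int_def order_trans)
        have "lcomb ys \<in> induced u"
          unfolding ys_def using lcomb_filter_induced l induced_trans by blast
        moreover have "col (lcomb ys) = e + \<chi> K"
          using col_lcomb ys by simp
        ultimately show "e + \<chi> K \<in> ?C"
          using ys by (intro image_eqI[of _ _ "lcomb ys"]) (auto simp: size1_size)
      qed
      then have "card ((+) e ` \<chi> ` nsets Y k) \<le> card ?C"
        by (intro card_mono) auto
      moreover have "card ((+) e ` \<chi> ` nsets Y k) = card (\<chi> ` nsets Y k)"
        by (intro card_image) simp
      moreover have "Y \<in> nsets {..<N} t"
        using Y xs by (simp add: nsets_def subset_trans)
      ultimately show ?thesis
        using many[of Y] by linarith
    next
      case s
      have size: "size w = k" if "shape w = v" "size v = k" for w :: "nat tree" and v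
        using that by (metis size_map_tree)
      obtain w where w: "w \<in> induced u" "shape w = rcomb (replicate k ())"
        using s[of "rcomb (replicate k ())"] by auto
      then obtain xs where xs: "w = rcomb xs"
        using shape_rcombD by blast
      obtain w' where w': "w' \<in> induced u" "shape w' = lcomb (replicate k ())"
        using s[of "lcomb (replicate k ())"] by auto
      then obtain xs' where xs': "w' = lcomb xs'"
        using shape_lcombD by blast
      have len: "length xs = k" "length xs' = k"
        using size[OF w(2)] size[OF w'(2)] xs xs' by auto
      \<comment> \<open>Only the range of \<chi> is known for these two combs, hence the arbitrary
        \<open>c\<close> and \<open>c'\<close> in \<open>shapes\<close>.\<close>
      have less: "\<chi> (set xs) < q" "\<chi> (set xs') < q"
        using ind[OF w(1)] ind[OF w'(1)] len xs xs' by (auto intro!: chi_less)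
      have "\<chi> (set xs) \<in> ?C"
        using w xs len col_rcomb by (intro image_eqI[of _ _ w]) (auto simp: size1_size)
      moreover have "e + \<chi> (set xs') \<in> ?C"
        using w' xs' len col_lcomb by (intro image_eqI[of _ _ w']) (auto simp: size1_size)
      moreover have "b + g v \<in> ?C" if v: "v \<in> noncombs k" for v
      proof -
        from v have "size v = k" by (simp add: noncombs_def)
        then obtain z where z: "z \<in> induced u" "shape z = v"
          using s by blast
        have "size z = k"
          using size z \<open>size v = k\<close> by blast
        have "z \<noteq> rcomb zs" "z \<noteq> lcomb zs" for zs
          using v z \<open>size z = k\<close> by (auto simp: noncombs_def map_replicate_const)
        then have "col z = b + g v"
          using z by (simp add: col_def)
        then show ?thesis
          using z \<open>size z = k\<close> by (intro image_eqI[of _ _ z]) (auto simp: size1_size)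
      qed
      ultimately have "card (insert (\<chi> (set xs)) (insert (e + \<chi> (set xs')) 
          ((\<lambda>v. b + g v) ` noncombs k))) \<le> card ?C"
        by (intro card_mono) auto
      with shapes[OF less] show ?thesis
        by linarith
    qed
  qed (use assms in auto)
qed

text \<open>In a single shared palette comb colours may repeat those of other shapes, so the Catalan
  number minus two other shapes must supply all \<open>p\<close> colours.\<close>

lemma step_up_same_colours:
  assumes "\<not> ramsey_prop k t q p N" "k \<ge> 2" "2 \<le> p" "p \<le> q" "t \<ge> 1" "(2 * t) ^ k \<le> m"
    and "real p \<le> catalan k - 2"
  shows "2 ^ N < ramsey_num (k + 1) m q p"
proof -
  have fin: "finite (noncombs k)"
    by (simp add: noncombs_def finite_binary_trees)
  moreover have "p \<le> card (noncombs k)"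
    using card_noncombs[of k] assms(7) by linarith
  ultimately obtain g where g: "g ` noncombs k = {..<p}" "\<And>x. g x < p"
    using ex_surjection_lessThan[of "noncombs k" p] assms(3) by auto
  show ?thesis
  proof (rule step_up_combs[where q = q and e = 0 and b = 0 and g = g])
    fix c c' :: nat
    have "card {..<p} \<le> card (insert c (insert (0 + c') ((\<lambda>v. 0 + g v) ` noncombs k)))"
      using g fin by (intro card_mono) auto
    then show "p \<le> card (insert c (insert (0 + c') ((\<lambda>v. 0 + g v) ` noncombs k)))"
      by simp
  next
    show "0 + g v < q" for v
      using g(2)[of v] assms(4) by simp
  qed (use assms in auto)
qed

text \<open>With three disjoint palettes each kind of comb adds a colour of its own, so
  \<open>p - 2\<close> colours on the other shapes suffice.\<close>

lemma step_up_more_colours: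
  assumes "\<not> ramsey_prop k t q p N" "k \<ge> 2" "3 \<le> p" "t \<ge> 1" "(2 * t) ^ k \<le> m"
    and "real p \<le> catalan k"
  shows "2 ^ N < ramsey_num (k + 1) m (2 * q + p) p"
proof -
  have fin: "finite (noncombs k)"
    by (simp add: noncombs_def finite_binary_trees)
  moreover have "p - 2 \<le> card (noncombs k)"
    using card_noncombs[of k] assms(6) by linarith
  ultimately obtain g where g: "g ` noncombs k = {..<p - 2}" "\<And>x. g x < p - 2"
    using ex_surjection_lessThan[of "noncombs k" "p - 2"] assms(3) by auto
  show ?thesis
  proof (rule step_up_combs[where q = q and e = q and b = "2 * q" and g = g])
    fix c c' assume c: "c < q" "c' < q"
    have "card ((\<lambda>v. 2 * q + g v) ` noncombs k) = card ((+) (2 * q) ` g ` noncombs k)"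
      by (simp add: image_image)
    also have "\<dots> = p - 2"
      unfolding g(1) by (subst card_image) auto
    finally show "p \<le> card (insert c (insert (q + c') ((\<lambda>v. 2 * q + g v) ` noncombs k)))"
      using c fin assms(3) by (subst card_insert_disjoint; (subst card_insert_disjoint)?) auto
  next
    show "2 * q + g v < 2 * q + p" for v
      using g(2)[of v] by simp
  qed (use assms in auto)
qed

section \<open>Stepping up with order patterns\<close>

text \<open>If \<open>ds\<close> lists the splitting levels of consecutive leaves \<open>x\<^sub>1, \<dots>, x\<^sub>2\<^sub>k\<close> then
  \<open>evens ds\<close> lists those of the pairs \<open>x\<^sub>1 x\<^sub>2\<close>, \<open>x\<^sub>3 x\<^sub>4\<close>, \<dots>\<close>

fun evens :: "'a list \<Rightarrow> 'a list" where
  "evens [] = []"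
| "evens [x] = [x]"
| "evens (x # y # zs) = x # evens zs"

text \<open>An odd number of inner nodes means an even number of leaves, so no pair straddles the
  separating label \<open>a\<close>, which is skipped.\<close>

lemma evens_append: "odd (length xs) \<Longrightarrow> evens (xs @ a # ys) = evens xs @ evens ys"
  by (induction xs rule: evens.induct) auto

lemma length_evens: "length (evens xs) = (length xs + 1) div 2"
  by (induction xs rule: evens.induct) auto

lemma set_evens: "set (evens xs) \<subseteq> set xs"
  by (induction xs rule: evens.induct) auto

lemma distinct_evens: "distinct xs \<Longrightarrow> distinct (evens xs)"
proof (induction xs rule: evens.induct)
  case (3 x y zs)
  then show ?case using set_evens[of zs] by auto
qed auto

definition pairable :: "'a tree \<Rightarrow> 'a list \<Rightarrow> bool" where
  "pairable u zs \<longleftrightarrow> zs = [] \<or> (\<exists>w\<in>induced u. odd (size w) \<and> evens (inorder w) = zs)"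

lemma pairable_Nil [simp]: "pairable u []"
  by (simp add: pairable_def)

lemma pairableI: "w \<in> induced u \<Longrightarrow> odd (size w) \<Longrightarrow> evens (inorder w) = zs \<Longrightarrow> pairable u zs"
  by (auto simp: pairable_def)

lemma pairable_induced: "pairable w zs \<Longrightarrow> w \<in> induced u \<Longrightarrow> pairable u zs"
  unfolding pairable_def using induced_trans by blast

lemma pairable_left: "pairable l zs \<Longrightarrow> pairable (Node l a r) zs"
  and pairable_right: "pairable r zs \<Longrightarrow> pairable (Node l a r) zs"
  unfolding pairable_def by (blast intro: induced_leftI induced_rightI)+

lemma pairable_append:
  assumes "pairable l xs" "pairable r ys"
  shows "pairable (Node l a r) (xs @ ys)"
proof (cases "xs = [] \<or> ys = []")
  case True
  then show ?thesis using assms pairable_left pairable_right by fastforce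
next
  case False
  then obtain w w' where "w \<in> induced l" "odd (size w)" "evens (inorder w) = xs"
    "w' \<in> induced r" "odd (size w')" "evens (inorder w') = ys"
    using assms by (auto simp: pairable_def)
  then show ?thesis
    by (intro pairableI[of "Node w a w'"] induced_NodeI) (auto simp: evens_append)
qed

lemma pairable_singleton: "a \<in> set_tree u \<Longrightarrow> pairable u [a]"
proof (induction u)
  case (Node l b r)
  then consider "a = b" | "a \<in> set_tree l" | "a \<in> set_tree r"
    by auto
  then show ?case
  proof cases
    case 1
    then show ?thesis
      by (intro pairableI[of "Node Leaf a Leaf"]) (auto intro: induced_NodeI simp del: induced.simps)
  next
    case 2
    then show ?thesis by (intro pairable_left Node.IH)
  next
    case 3
    then show ?thesis by (intro pairable_right Node.IH)
  qed
qed simp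

text \<open>Two consecutive leaves form a pair split at \<open>x\<close>; the next label
  \<open>y\<close> is spent on separating this pair from the following one. Hence only every second
  label is used.\<close>

lemma pairable_rcomb: "pairable (rcomb xs) (filter P (evens xs))"
proof (induction xs rule: evens.induct)
  case (2 x)
  then show ?case by (auto intro: pairable_singleton)
next
  case (3 x y zs)
  let ?zs = "filter P (evens zs)"
  have IH: "pairable (rcomb (x # y # zs)) ?zs"
    using 3 by (auto intro: pairable_right)
  show ?case
  proof (cases "P x")
    case True
    have "pairable (rcomb (x # y # zs)) (x # ?zs)"
    proof (cases "?zs = []")
      case True
      then show ?thesis by (auto intro: pairable_singleton)
    next
      case False
      with 3 obtain w where "w \<in> induced (rcomb zs)" "odd (size w)" "evens (inorder w) = ?zs"
        by (auto simp: pairable_def)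
      then show ?thesis
        by (intro pairableI[of "Node Leaf x (Node Leaf y w)"])
          (auto intro!: induced_NodeI simp del: induced.simps)
    qed
    then show ?thesis using True by simp
  next
    case False
    then show ?thesis using IH by simp
  qed
qed simp

lemma pairable_lcomb: "pairable (lcomb xs) (rev (filter P (evens xs)))"
proof (induction xs rule: evens.induct)
  case (2 x)
  then show ?case by (auto intro: pairable_singleton)
next
  case (3 x y zs)
  let ?zs = "rev (filter P (evens zs))"
  have IH: "pairable (lcomb (x # y # zs)) ?zs"
    using 3 by (auto intro: pairable_left)
  show ?case
  proof (cases "P x")
    case True
    have "pairable (lcomb (x # y # zs)) (?zs @ [x])"
    proof (cases "?zs = []")
      case True
      then show ?thesis by (auto intro: pairable_singleton)
    next
      case False
      with 3 obtain w where "w \<in> induced (lcomb zs)" "odd (size w)" "evens (inorder w) = ?zs"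
        by (auto simp: pairable_def)
      then show ?thesis
        by (intro pairableI[of "Node (Node w y Leaf) x Leaf"])
          (auto intro!: induced_NodeI simp: evens_append simp del: induced.simps)
    qed
    then show ?thesis using True by simp
  next
    case False
    then show ?thesis using IH by simp
  qed
qed simp

text \<open>The order of \<open>zs\<close> is left open because \<chi> depends only on the set of
  labels.\<close>

definition all_pairable :: "'a tree \<Rightarrow> 'a set \<Rightarrow> bool" where
  "all_pairable u Y \<longleftrightarrow> (\<forall>K\<subseteq>Y. \<exists>zs. distinct zs \<and> set zs = K \<and> pairable u zs)"

lemma all_pairable_rcomb:
  assumes "rcomb xs \<in> induced u" "distinct xs"
  shows "all_pairable u (set (evens xs))"
  unfolding all_pairable_def
proof (intro allI impI)
  fix K assume "K \<subseteq> set (evens xs)"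
  then show "\<exists>zs. distinct zs \<and> set zs = K \<and> pairable u zs"
    using assms pairable_rcomb[of xs "\<lambda>x. x \<in> K"] pairable_induced
    by (intro exI[of _ "filter (\<lambda>x. x \<in> K) (evens xs)"]) (auto simp: distinct_evens)
qed

lemma all_pairable_lcomb:
  assumes "lcomb xs \<in> induced u" "distinct xs"
  shows "all_pairable u (set (evens xs))"
  unfolding all_pairable_def
proof (intro allI impI)
  fix K assume "K \<subseteq> set (evens xs)"
  then show "\<exists>zs. distinct zs \<and> set zs = K \<and> pairable u zs"
    using assms pairable_lcomb[of xs "\<lambda>x. x \<in> K"] pairable_induced
    by (intro exI[of _ "rev (filter (\<lambda>x. x \<in> K) (evens xs))"]) (auto simp: distinct_evens)
qed

section \<open>Labels at a fixed depth\<close>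

fun at_depth :: "nat \<Rightarrow> 'a tree \<Rightarrow> 'a set" where
  "at_depth n Leaf = {}"
| "at_depth 0 (Node l a r) = {a}"
| "at_depth (Suc n) (Node l a r) = at_depth n l \<union> at_depth n r"

lemma finite_at_depth [simp]: "finite (at_depth n u)"
  by (induction n u rule: at_depth.induct) auto

lemma at_depth_subset: "at_depth n u \<subseteq> set_tree u"
  by (induction n u rule: at_depth.induct) auto

lemma set_tree_at_depth: "set_tree u \<subseteq> (\<Union>n<height u. at_depth n u)"
proof (induction u)
  case (Node l a r)
  show ?case
  proof
    fix x assume "x \<in> set_tree (Node l a r)"
    then consider "x = a" | "x \<in> set_tree l" | "x \<in> set_tree r"
      by auto
    then show "x \<in> (\<Union>n<height (Node l a r). at_depth n (Node l a r))"
    proof cases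
      case 1
      then show ?thesis by (intro UN_I[of 0]) auto
    next
      case 2
      then obtain n where "n < height l" "x \<in> at_depth n l"
        using Node by blast
      then show ?thesis by (intro UN_I[of "Suc n"]) auto
    next
      case 3
      then obtain n where "n < height r" "x \<in> at_depth n r"
        using Node by blast
      then show ?thesis by (intro UN_I[of "Suc n"]) auto
    qed
  qed
qed simp

text \<open>Distinct nodes of equal depth have disjoint sets of leaves below them, so a pair split
  at each can be chosen independently.\<close>

lemma all_pairable_at_depth: "all_pairable u (at_depth n u)"
proof (induction n u rule: at_depth.induct)
  case (1 n)
  show ?case by (auto simp: all_pairable_def)
next
  case (2 l a r)
  have "\<exists>zs. distinct zs \<and> set zs = K \<and> pairable (Node l a r) zs" if "K \<subseteq> {a}" for K
  proof (cases "K = {}")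
    case False
    with that have "K = {a}" by auto
    then show ?thesis
      by (intro exI[of _ "[a]"]) (auto intro: pairable_singleton)
  qed auto
  then show ?case by (simp add: all_pairable_def)
next
  case (3 n l a r)
  show ?case
    unfolding all_pairable_def
  proof (intro allI impI)
    fix K assume K: "K \<subseteq> at_depth (Suc n) (Node l a r)"
    \<comment> \<open>A label occurring on both sides is taken from the left only, which keeps the
      list distinct.\<close>
    then have sub: "K \<inter> at_depth n l \<subseteq> at_depth n l" "K - at_depth n l \<subseteq> at_depth n r"
      by auto
    then obtain xs where xs: "distinct xs" "set xs = K \<inter> at_depth n l" "pairable l xs"
      using 3(1) unfolding all_pairable_def by blast
    from sub obtain ys where ys: "distinct ys" "set ys = K - at_depth n l" "pairable r ys"
      using 3(2) unfolding all_pairable_def by blast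
    from xs ys have "distinct (xs @ ys)" "set (xs @ ys) = K"
      by auto
    with pairable_append[OF xs(3) ys(3)]
    show "\<exists>zs. distinct zs \<and> set zs = K \<and> pairable (Node l a r) zs"
      by blast
  qed
qed

text \<open>Order-shattering: \<open>as \<in> shattered u\<close> if \<open>u\<close> contains a complete binary tree all of whose
  nodes of depth \<open>i\<close> carry the label \<open>as ! i\<close>. The bound is the one of Pajor's proof of the
  Sauer-Shelah lemma.\<close>

fun shattered :: "'a tree \<Rightarrow> 'a list set" where
  "shattered Leaf = {[]}"
| "shattered (Node l a r) = shattered l \<union> shattered r \<union> Cons a ` (shattered l \<inter> shattered r)"

lemma finite_shattered [simp]: "finite (shattered u)"
  by (induction u) auto

lemma shattered_NodeE:
  assumes "as \<in> shattered (Node l a r)"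
  obtains "as \<in> shattered l" | "as \<in> shattered r"
    | bs where "as = a # bs" "bs \<in> shattered l" "bs \<in> shattered r"
  using assms unfolding shattered.simps by blast

lemma shattered_subset: "as \<in> shattered u \<Longrightarrow> set as \<subseteq> set_tree u"
proof (induction u arbitrary: as)
  case (Node l a r)
  from Node.prems show ?case
  proof (cases rule: shattered_NodeE)
    case 1
    then have "set as \<subseteq> set_tree l" by (rule Node.IH)
    then show ?thesis by auto
  next
    case 2
    then have "set as \<subseteq> set_tree r" by (rule Node.IH)
    then show ?thesis by auto
  next
    case (3 bs)
    from 3(2) have "set bs \<subseteq> set_tree l" by (rule Node.IH)
    then show ?thesis using 3(1) by auto
  qed
qed simp

lemma shattered_distinct: "as \<in> shattered u \<Longrightarrow> path_distinct u \<Longrightarrow> distinct as"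
proof (induction u arbitrary: as)
  case (Node l a r)
  from Node.prems(1) show ?case
  proof (cases rule: shattered_NodeE)
    case (3 bs)
    then show ?thesis
      using Node shattered_subset[of bs l] by auto
  qed (use Node in auto)
qed simp

text \<open>Lists starting with \<open>a\<close> are new, since \<open>a\<close> occurs in neither
  subtree. The union and the intersection of the two families then count each family once.\<close>

lemma size1_le_card_shattered: "path_distinct u \<Longrightarrow> size1 u \<le> card (shattered u)"
proof (induction u)
  case (Node l a r)
  have "Cons a ` (shattered l \<inter> shattered r) \<inter> (shattered l \<union> shattered r) = {}"
    using Node.prems shattered_subset[where u = l] shattered_subset[where u = r] by force
  then have "card (shattered (Node l a r)) =
      card (shattered l \<union> shattered r) + card (shattered l \<inter> shattered r)"
    by (simp add: card_Un_disjoint card_image Int_commute)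
  also have "\<dots> = card (shattered l) + card (shattered r)"
    using card_Un_Int[of "shattered l" "shattered r"] by simp
  finally show ?case
    using Node by simp
qed simp

text \<open>The labels \<open>bs\<close> only provide branchings: at each, a pair with the next
  wanted label is taken on the left and the rest on the right, where \<open>cs\<close> is still
  available. The last entry needs no branching, hence the \<open>+ 1\<close>.\<close>

lemma pairable_shattered:
  "bs @ cs \<in> shattered u \<Longrightarrow> length zs \<le> length bs + 1 \<Longrightarrow> set zs \<subseteq> set cs \<Longrightarrow> pairable u zs"
proof (induction u arbitrary: bs zs)
  case Leaf
  then show ?case by simp
next
  case (Node l a r)
  have single: "pairable v [z]" if "as @ cs \<in> shattered v" "z \<in> set cs" for v as z
  proof -
    have "z \<in> set (as @ cs)" using that by simp
    then show ?thesis
      using shattered_subset[OF that(1)] by (intro pairable_singleton) blast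
  qed
  consider "zs = []" | z where "zs = [z]" | z zs' where "zs = z # zs'" "zs' \<noteq> []"
    by (cases zs) auto
  then show ?case
  proof cases
    case 2
    then show ?thesis using single Node.prems by simp
  next
    case (3 z zs')
    from Node.prems(1) show ?thesis
    proof (cases rule: shattered_NodeE)
      case 1
      then show ?thesis using Node.prems(2,3) by (intro pairable_left Node.IH(1)[of bs])
    next
      case 2
      then show ?thesis using Node.prems(2,3) by (intro pairable_right Node.IH(2)[of bs])
    next
      case (3 as)
      \<comment> \<open>At least two entries remain, so \<open>bs\<close> is nonempty and its head
        is the root label.\<close>
      with \<open>zs = z # zs'\<close> \<open>zs' \<noteq> []\<close> Node.prems(2) obtain bs' where
        bs: "bs = a # bs'" "as = bs' @ cs"
        by (cases bs) auto
      then have "pairable l [z]"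
        using single[of bs' l z] 3 \<open>zs = z # zs'\<close> Node.prems(3) by simp
      moreover have "pairable r zs'"
        by (rule Node.IH(2)[of bs']) (use bs 3 \<open>zs = z # zs'\<close> Node.prems in auto)
      ultimately show ?thesis
        using pairable_append[of l "[z]" r zs'] \<open>zs = z # zs'\<close> by simp
    qed
  qed simp
qed

lemma card_lists_length_le_power:
  assumes "finite A" "card A \<le> M" "2 \<le> M"
  shows "card {xs. set xs \<subseteq> A \<and> length xs \<le> n} \<le> M ^ (n + 1)"
proof -
  have "(\<Sum>i\<le>n. card A ^ i) \<le> (\<Sum>i\<le>n. M ^ i)"
    using assms by (intro sum_mono power_mono) auto
  also have "\<dots> \<le> M ^ (n + 1)"
  proof (induction n)
    case (Suc n)
    have "(\<Sum>i\<le>Suc n. M ^ i) \<le> 2 * M ^ (n + 1)"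
      using Suc by simp
    also have "\<dots> \<le> M * M ^ (n + 1)"
      using assms by (intro mult_right_mono) auto
    finally show ?case by simp
  qed (use assms in simp)
  finally show ?thesis
    using assms by (simp add: card_lists_length_le)
qed

lemma all_pairable_or_shattered:
  assumes u: "path_distinct u" "(4 * t * t) ^ (2 * k) < size1 u" and "t \<ge> 1" "k \<ge> 1"
  shows "(\<exists>Y\<subseteq>set_tree u. t \<le> card Y \<and> all_pairable u Y) \<or>
    (\<exists>bs cs. bs @ cs \<in> shattered u \<and> length bs = k \<and> k \<le> length cs)"
proof (rule ccontr)
  assume neg: "\<not> ?thesis"
  then have small: "card Y < t" if "Y \<subseteq> set_tree u" "all_pairable u Y" for Y
    using that not_less by blast
  \<comment> \<open>Every second label of a comb is usable, so a comb with \<open>2 * t\<close>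
    nodes would give \<open>t\<close> usable labels.\<close>
  have short: "length xs < 2 * t" if "distinct xs" "set xs \<subseteq> set_tree u" "all_pairable u (set (evens xs))" for xs
  proof -
    have "card (set (evens xs)) < t"
      using that set_evens[of xs] by (intro small) auto
    then show ?thesis
      using distinct_card[OF distinct_evens[OF that(1)]] length_evens[of xs] by simp
  qed
  obtain xs ys where xy: "rcomb xs \<in> induced u" "lcomb ys \<in> induced u"
    "height u \<le> length xs + length ys"
    using height_le_combs by blast
  have "distinct xs" "distinct ys" "set xs \<subseteq> set_tree u" "set ys \<subseteq> set_tree u"
    using path_distinct_induced[OF xy(1)] path_distinct_induced[OF xy(2)]
      set_tree_induced[OF xy(1)] set_tree_induced[OF xy(2)] u by auto
  then have "height u \<le> 4 * t"
    using xy short[of xs] short[of ys] all_pairable_rcomb[of xs u] all_pairable_lcomb[of ys u]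
    by linarith
  have "card (set_tree u) \<le> card (\<Union>n<height u. at_depth n u)"
    using set_tree_at_depth[of u] by (intro card_mono) auto
  also have "\<dots> \<le> (\<Sum>n<height u. card (at_depth n u))"
    by (rule card_UN_le) simp
  also have "\<dots> \<le> (\<Sum>n<height u. t)"
    by (intro sum_mono less_imp_le small all_pairable_at_depth at_depth_subset)
  also have "\<dots> \<le> 4 * t * t"
    using \<open>height u \<le> 4 * t\<close> by simp
  finally have labels: "card (set_tree u) \<le> 4 * t * t" .
  \<comment> \<open>A longer list would split into \<open>k\<close> labels for branching and at
    least \<open>k\<close> labels to choose from.\<close>
  have "length as \<le> 2 * k - 1" if "as \<in> shattered u" for as
  proof (rule ccontr)
    assume "\<not> ?thesis"
    with that have "take k as @ drop k as \<in> shattered u" "length (take k as) = k" "k \<le> length (drop k as)"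
      by auto
    with neg show False by blast
  qed
  then have "shattered u \<subseteq> {as. set as \<subseteq> set_tree u \<and> length as \<le> 2 * k - 1}"
    using shattered_subset[of _ u] by blast
  then have "card (shattered u) \<le> card {as. set as \<subseteq> set_tree u \<and> length as \<le> 2 * k - 1}"
    by (intro card_mono finite_lists_length_le) auto
  also have "\<dots> \<le> (4 * t * t) ^ (2 * k - 1 + 1)"
    using labels \<open>t \<ge> 1\<close> by (intro card_lists_length_le_power) auto
  also have "\<dots> = (4 * t * t) ^ (2 * k)"
    using \<open>k \<ge> 1\<close> by simp
  finally show False
    using size1_le_card_shattered[OF u(1)] u(2) by linarith
qed

section \<open>Order patterns of label lists\<close>

definition pattern :: "nat list \<Rightarrow> nat list" where
  "pattern zs = map (\<lambda>x. card {y \<in> set zs. y < x}) zs"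

text \<open>An increasing relabelling preserves ranks, and the entries of a permutation of
  \<open>{..<k}\<close> are their own ranks.\<close>

lemma pattern_map:
  assumes "\<sigma> \<in> permutations_of_set {..<k}" "strict_mono_on {..<k} f"
  shows "pattern (map f \<sigma>) = \<sigma>"
proof -
  have "card {y \<in> f ` {..<k}. y < f i} = i" if "i < k" for i
  proof -
    have "{y \<in> f ` {..<k}. y < f i} = f ` {..<i}"
      using that strict_mono_on_less[OF assms(2)] by auto
    moreover have "inj_on f {..<i}"
      by (rule inj_on_subset[OF strict_mono_on_imp_inj_on[OF assms(2)]]) (use that in auto)
    ultimately show ?thesis
      by (simp add: card_image)
  qed
  then show ?thesis
    using permutations_of_setD[OF assms(1)] by (auto simp: pattern_def intro: map_idI)
qed

lemma ex_strict_mono_on: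
  fixes A :: "nat set"
  assumes "finite A" "k \<le> card A"
  shows "\<exists>f. strict_mono_on {..<k} f \<and> f ` {..<k} \<subseteq> A"
proof (intro exI conjI)
  let ?f = "\<lambda>i. sorted_list_of_set A ! i"
  show "strict_mono_on {..<k} ?f"
    using assms by (auto intro!: strict_mono_onI sorted_wrt_nth_less[OF strict_sorted_list_of_set])
  show "?f ` {..<k} \<subseteq> A"
    using assms nth_mem[of _ "sorted_list_of_set A"] by auto
qed

lemma step_up_patterns:
  assumes notr: "\<not> ramsey_prop k t q p N" and "k \<ge> 1" "p \<ge> 2" "t \<ge> 1" "q \<ge> 1"
    and m: "(4 * t * t) ^ (2 * k) < m" and "p \<le> fact k"
  shows "2 ^ N < ramsey_num (2 * k) m (q * p) p"
proof -
  from notr obtain \<chi> where chi: "\<chi> \<in> nsets {..<N} k \<rightarrow> {..<q}"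
    and many: "\<And>T. T \<in> nsets {..<N} t \<Longrightarrow> p \<le> card (\<chi> ` nsets T k)"
    unfolding ramsey_prop_def by (auto simp: not_less)
  obtain g where g: "g ` permutations_of_set {..<k} = {..<p}" "\<And>x. g x < p"
    using ex_surjection_lessThan[of "permutations_of_set {..<k}" p] assms by auto
  \<comment> \<open>The \<chi>-colour and the pattern colour are the digits in base
    \<open>q\<close>, recovered by \<open>mod q\<close> and \<open>div q\<close>. Different pairs
    may split at the same level; the default 0 keeps the first digit below \<open>q\<close> in that
    case.\<close>
  define col where "col w =
    (let zs = evens (inorder w) in (if distinct zs then \<chi> (set zs) else 0) + q * g (pattern zs))"
    for w
  have chi_less: "\<chi> (set zs) < q" if "distinct zs" "length zs = k" "set zs \<subseteq> {..<N}" for zs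
    using that chi by (auto simp: nsets_def Pi_iff distinct_card)
  have pair: "\<exists>w\<in>induced u. size1 w = 2 * k \<and> evens (inorder w) = zs"
    if zs: "pairable u zs" "length zs = k" for u :: "nat tree" and zs
  proof -
    from that \<open>k \<ge> 1\<close> obtain w where "w \<in> induced u" "odd (size w)" "evens (inorder w) = zs"
      unfolding pairable_def by force
    moreover from this have "size1 w = 2 * k"
      using zs(2) length_evens[of "inorder w"] by (auto simp: size1_size elim!: oddE)
    ultimately show ?thesis by blast
  qed
  show ?thesis
  proof (rule ramsey_num_gt_two_power[where col = col])
    fix w assume w: "path_distinct w" "set_tree w \<subseteq> {..<N}" "size1 w = 2 * k"
    let ?zs = "evens (inorder w)"
    have "length ?zs = k" "set ?zs \<subseteq> {..<N}"
      using w set_evens[of "inorder w"] by (auto simp: length_evens size1_size)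
    then have "(if distinct ?zs then \<chi> (set ?zs) else 0) < q"
      using chi_less[of ?zs] \<open>q \<ge> 1\<close> by auto
    then have "col w < q * (g (pattern ?zs) + 1)"
      by (simp add: col_def Let_def)
    also have "\<dots> \<le> q * p"
      using g(2)[of "pattern ?zs"] by (intro mult_left_mono) auto
    finally show "col w < q * p" .
  next
    fix u assume u: "path_distinct u" "set_tree u \<subseteq> {..<N}" "size1 u = m"
    let ?C = "col ` {w \<in> induced u. size1 w = 2 * k}"
    have set_N: "set (evens (inorder w)) \<subseteq> {..<N}" if "w \<in> induced u" for w
      using set_evens[of "inorder w"] set_tree_induced[OF that] u by auto
    consider (Y) Y where "Y \<subseteq> set_tree u" "t \<le> card Y" "all_pairable u Y"
      | (s) bs cs where "bs @ cs \<in> shattered u" "length bs = k" "k \<le> length cs"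
      using all_pairable_or_shattered[of u t k] assms u by auto
    then show "p \<le> card ?C"
    proof cases
      case Y
      then obtain T where T: "T \<subseteq> Y" "card T = t" "finite T"
        using obtain_subset_with_card_n by metis
      have "\<chi> ` nsets T k \<subseteq> (\<lambda>c. c mod q) ` ?C"
      proof safe
        fix K assume K: "K \<in> nsets T k"
        then have "K \<subseteq> Y"
          using T by (auto simp: nsets_def)
        then obtain zs where zs: "distinct zs" "set zs = K" "pairable u zs"
          using Y unfolding all_pairable_def by blast
        with K have "length zs = k"
          by (auto simp: nsets_def distinct_card)
        with pair zs obtain w where w: "w \<in> induced u" "size1 w = 2 * k" "evens (inorder w) = zs"
          by blast
        then have "\<chi> K < q"
          using chi_less[of zs] zs set_N[of w] \<open>length zs = k\<close> by auto
        then have "\<chi> K = col w mod q"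
          using w zs by (simp add: col_def)
        with w show "\<chi> K \<in> (\<lambda>c. c mod q) ` ?C"
          by blast
      qed
      then have "card (\<chi> ` nsets T k) \<le> card ((\<lambda>c. c mod q) ` ?C)"
        by (intro card_mono) auto
      also have "\<dots> \<le> card ?C"
        by (intro card_image_le) auto
      finally have "card (\<chi> ` nsets T k) \<le> card ?C" .
      moreover have "T \<in> nsets {..<N} t"
        using T Y u by (auto simp: nsets_def)
      ultimately show ?thesis
        using many[of T] by linarith
    next
      case s
      then have "distinct cs"
        using shattered_distinct u by fastforce
      then obtain f where f: "strict_mono_on {..<k} f" "f ` {..<k} \<subseteq> set cs"
        using ex_strict_mono_on[of "set cs" k] s by (auto simp: distinct_card)
      \<comment> \<open>Listing \<open>k\<close> labels from \<open>cs\<close> in the order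
        prescribed by a permutation realises that permutation as a pattern.\<close>
      have "g ` permutations_of_set {..<k} \<subseteq> (\<lambda>c. c div q) ` ?C"
      proof safe
        fix \<sigma> :: "nat list" assume \<sigma>: "\<sigma> \<in> permutations_of_set {..<k}"
        let ?zs = "map f \<sigma>"
        have zs: "set ?zs \<subseteq> set cs" "length ?zs = k"
          using permutations_of_setD[OF \<sigma>] f distinct_card[of \<sigma>] by auto
        have "distinct ?zs"
          using permutations_of_setD[OF \<sigma>] strict_mono_on_imp_inj_on[OF f(1)]
          by (simp add: distinct_map)
        have "pairable u ?zs"
          using pairable_shattered[OF s(1), of ?zs] s zs by simp
        with pair zs obtain w where w: "w \<in> induced u" "size1 w = 2 * k" "evens (inorder w) = ?zs"
          by blast
        have "\<chi> (set ?zs) < q"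
          using chi_less[of ?zs] zs \<open>distinct ?zs\<close> set_N[OF w(1)] w(3) by auto
        then have "g \<sigma> = col w div q"
          using w \<open>distinct ?zs\<close> pattern_map[OF \<sigma> f(1)] by (simp add: col_def Let_def)
        with w show "g \<sigma> \<in> (\<lambda>c. c div q) ` ?C"
          by blast
      qed
      then have "card {..<p} \<le> card ((\<lambda>c. c div q) ` ?C)"
        unfolding g(1) by (intro card_mono) auto
      also have "\<dots> \<le> card ?C"
        by (intro card_image_le) auto
      finally show ?thesis by simp
    qed
  qed (use assms in auto)
qed


theorem theorem1p3:
  fixes k q p :: nat
  assumes "k \<ge> 3" and "q \<ge> 3" and "p \<ge> 3" and "q \<ge> p"
  shows "\<exists>c::real. c \<ge> 1 \<and> (\<exists>t0::nat. \<forall>t::nat. t > t0 \<longrightarrow>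
      (real p \<le> catalan k - 2 \<longrightarrow>
         ramsey_num_real (k + 1) (real t powr c) q p > 2 ^ (ramsey_num k t q p - 1)) \<and>
      (real p \<le> catalan k \<longrightarrow>
         ramsey_num_real (k + 1) (real t powr c) (2 * q + p) p > 2 ^ (ramsey_num k t q p - 1)) \<and>
      (p \<le> fact k \<longrightarrow>
         ramsey_num_real (2 * k) (real t powr c) (q * p) p > 2 ^ (ramsey_num k t q p - 1)))"
\<comment> \<open>For \<open>t \<ge> 2\<close> both size thresholds are at most
  \<open>t ^ (8 * k)\<close>; the extra factor \<open>t\<close> makes the bound for (c) strict. The
  exponent is an integer, so the ceiling disappears.\<close>
proof (intro exI[of _ "real (8 * k + 1)"] conjI exI[of _ "1::nat"] allI impI)
  fix t :: nat
  assume t: "t > 1"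
  have num: "ramsey_num_real s (real t powr real (8 * k + 1)) Q p = ramsey_num s (t ^ (8 * k + 1)) Q p"
    for s Q
  proof -
    have "real t powr real (8 * k + 1) = real (t ^ (8 * k + 1))"
      using t by (simp only: powr_realpow of_nat_power of_nat_0_less_iff)
    then show ?thesis
      unfolding ramsey_num_real_def by (simp only: ceiling_of_nat nat_int)
  qed
  \<comment> \<open>The Ramsey number is positive, so subtracting 1 gives a smaller number, where by
    minimality a good colouring exists.\<close>
  have "t \<le> ramsey_num k t q p"
    using assms by (intro ramsey_num_ge) auto
  with t have "ramsey_num k t q p - 1 < ramsey_num k t q p"
    by linarith
  then have notr: "\<not> ramsey_prop k t q p (ramsey_num k t q p - 1)"
    by (subst (asm) (2) ramsey_num_def) (rule not_less_Least)
  have "(2 * t) ^ k \<le> (t * t) ^ k"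
    using t by (intro power_mono mult_right_mono) auto
  also have "\<dots> = t ^ (2 * k)"
    by (simp add: power_mult power2_eq_square)
  also have "\<dots> \<le> t ^ (8 * k + 1)"
    using t by (intro power_increasing) auto
  finally have m: "(2 * t) ^ k \<le> t ^ (8 * k + 1)" .
  have "4 * t * t \<le> (t * t) * t * t"
    using t mult_le_mono[of 2 t 2 t] by (intro mult_right_mono) auto
  then have "(4 * t * t) ^ (2 * k) \<le> ((t * t) * t * t) ^ (2 * k)"
    by (intro power_mono) auto
  also have "\<dots> = (t ^ 4) ^ (2 * k)"
    by (simp add: power4_eq_xxxx)
  also have "\<dots> = t ^ (8 * k)"
    by (simp flip: power_mult)
  also have "\<dots> < t ^ (8 * k + 1)"
    using t by (intro power_strict_increasing) auto
  finally have m': "(4 * t * t) ^ (2 * k) < t ^ (8 * k + 1)" .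
  show "2 ^ (ramsey_num k t q p - 1) < ramsey_num_real (k + 1) (real t powr real (8 * k + 1)) q p"
    if "real p \<le> catalan k - 2"
    unfolding num using step_up_same_colours[OF notr] assms t m that by simp
  show "2 ^ (ramsey_num k t q p - 1) <
      ramsey_num_real (k + 1) (real t powr real (8 * k + 1)) (2 * q + p) p"
    if "real p \<le> catalan k"
    unfolding num using step_up_more_colours[OF notr] assms t m that by simp
  show "2 ^ (ramsey_num k t q p - 1) <
      ramsey_num_real (2 * k) (real t powr real (8 * k + 1)) (q * p) p"
    if "p \<le> fact k"
    unfolding num using step_up_patterns[OF notr] assms t m' that by simp
qed simp

end
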